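(* Consider the TSTMR iteration (defined in the context) for $Ax=b$, and let $k\ge 1$. Suppose that the vectors $\delta^{(k+\frac12)}_1$ and $\delta^{(k+\frac12)}_2$ at the $k$th step are nonzero. If the matrix $W_A(\delta^{(k+\frac12)}_1,\delta^{(k+\frac12)}_2)$ is singular, then there exists a scalar $\nu$ such that $$x^*=(1-\nu)\,x^{(k+\frac12)}+\nu\, x^{((k-1)+\frac12)}$$ is the exact solution of $Ax=b$.
   Context: Let $A\in\mathbb{R}^{n\times n}$ be nonsingular and $b\in\mathbb{R}^n$. Let $A=\tilde M-\tilde N=\hat M-\hat N$ be two given splittings with $\tilde M,\hat M\in\mathbb{R}^{n\times n}$ nonsingular. $\langle\cdot,\cdot\rangle$ is the Euclidean inner product and $\|\cdot\|$ the Euclidean norm. For $x,y\in\mathbb{R}^n$ set $$W_A(x,y)=\begin{bmatrix}\langle Ax,Ax\rangle & \langle Ay,Ax\rangle\\ \langle Ax,Ay\rangle & \langle Ay,Ay\rangle\end{bmatrix}.$$ The TSTMR method. Given an arbitrary $x^{(0)}\in\mathbb{R}^n$, write $r^{(j)}=b-Ax^{(j)}$ and $r^{(j+\frac12)}=b-Ax^{(j+\frac12)}$ for residuals, and for all $j\ge 0$ set $\delta_1^{(j)}=\tilde M^{-1}r^{(j)}$, $\delta_1^{(j+\frac12)}=\hat M^{-1}r^{(j+\frac12)}$; for $j\ge1$ set $\delta_2^{(j)}=\delta_1^{(j)}-\delta_1^{(j-1)}$ and $\delta_2^{(j+\frac12)}=\delta_1^{(j+\frac12)}-\delta_1^{((j-1)+\frac12)}$.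 First step: $x^{(\frac12)}=x^{(0)}+\beta_0\delta_1^{(0)}$ and $x^{(1)}=x^{(\frac12)}+\gamma_0\delta_1^{(\frac12)}$ with $$\beta_0=\frac{\langle r^{(0)},A\delta_1^{(0)}\rangle}{\|A\delta_1^{(0)}\|^2},\qquad \gamma_0=\frac{\langle r^{(\frac12)},A\delta_1^{(\frac12)}\rangle}{\|A\delta_1^{(\frac12)}\|^2}.$$ For $j\ge1$: $x^{(j+\frac12)}=x^{(j)}+\beta_1^{(j)}\delta_1^{(j)}+\beta_2^{(j)}\delta_2^{(j)}$ and $x^{(j+1)}=x^{(j+\frac12)}+\gamma_1^{(j)}\delta_1^{(j+\frac12)}+\gamma_2^{(j)}\delta_2^{(j+\frac12)}$, where the coefficients solve $$W_A(\delta_1^{(j)},\delta_2^{(j)})\begin{bmatrix}\beta_1^{(j)}\\ \beta_2^{(j)}\end{bmatrix}=\begin{bmatrix}\langle r^{(j)},A\delta_1^{(j)}\rangle\\ \langle r^{(j)},A\delta_2^{(j)}\rangle\end{bmatrix},\qquad W_A(\delta_1^{(j+\frac12)},\delta_2^{(j+\frac12)})\begin{bmatrix}\gamma_1^{(j)}\\ \gamma_2^{(j)}\end{bmatrix}=\begin{bmatrix}\langle r^{(j+\frac12)},A\delta_1^{(j+\frac12)}\rangle\\ \langle r^{(j+\frac12)},A\delta_2^{(j+\frac12)}\rangle\end{bmatrix}.$$ It is understood that the iteration has been carried out without breakdown (all denominators nonzero, all $2\times2$ matrices nonsingular) up to the computation of the iterates appearing in the statement. *)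

theory Defs
  imports "HOL-Analysis.Analysis"
begin

definition residual :: "real^'n^'n \<Rightarrow> real^'n \<Rightarrow> real^'n \<Rightarrow> real^'n"
  where "residual A b v = b - A *v v"

definition W :: "real^'n^'n \<Rightarrow> real^'n \<Rightarrow> real^'n \<Rightarrow> real^2^2"
  where "W A u v = vector [vector [(A *v u) \<bullet> (A *v u), (A *v v) \<bullet> (A *v u)],
                           vector [(A *v u) \<bullet> (A *v v), (A *v v) \<bullet> (A *v v)]]"

(* The iterates are stored in two sequences: x j is the iterate with index j, and xh j is the
   iterate with index j + 1/2.  In delta1 and delta2 the argument y is one of these sequences
   and M the matrix of the splitting belonging to it, so that delta1 A b Mt x j has index j and
   delta1 A b Mh xh j has index j + 1/2.  delta2 is only meaningful for j >= 1. *)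

definition delta1 :: "real^'n^'n \<Rightarrow> real^'n \<Rightarrow> real^'n^'n \<Rightarrow> (nat \<Rightarrow> real^'n) \<Rightarrow> nat \<Rightarrow> real^'n"
  where "delta1 A b M y j = matrix_inv M *v residual A b (y j)"

definition delta2 :: "real^'n^'n \<Rightarrow> real^'n \<Rightarrow> real^'n^'n \<Rightarrow> (nat \<Rightarrow> real^'n) \<Rightarrow> nat \<Rightarrow> real^'n"
  where "delta2 A b M y j = delta1 A b M y j - delta1 A b M y (j - 1)"

(* In both step relations, the first conjunct says that the step does not break down. *)

definition one_param_step ::
    "real^'n^'n \<Rightarrow> real^'n \<Rightarrow> real^'n \<Rightarrow> real^'n \<Rightarrow> real^'n \<Rightarrow> bool"
  where "one_param_step A b d v v' \<longleftrightarrow>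
    (norm (A *v d))\<^sup>2 \<noteq> 0 \<and>
    v' = v + ((residual A b v \<bullet> (A *v d)) / (norm (A *v d))\<^sup>2) *\<^sub>R d"

definition two_param_step ::
    "real^'n^'n \<Rightarrow> real^'n \<Rightarrow> real^'n \<Rightarrow> real^'n \<Rightarrow> real^'n \<Rightarrow> real^'n \<Rightarrow> bool"
  where "two_param_step A b d1 d2 v v' \<longleftrightarrow>
    invertible (W A d1 d2) \<and>
    (\<exists>c1 c2. W A d1 d2 *v vector [c1, c2]
               = vector [residual A b v \<bullet> (A *v d1), residual A b v \<bullet> (A *v d2)] \<and>
             v' = v + c1 *\<^sub>R d1 + c2 *\<^sub>R d2)"

(* x and xh are TSTMR iterates, computed without breakdown up to and including the iterate
   xh k.  Nothing is required of the step from xh k to x (k + 1). *)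

definition TSTMR_upto_half ::
    "real^'n^'n \<Rightarrow> real^'n \<Rightarrow> real^'n^'n \<Rightarrow> real^'n^'n \<Rightarrow>
     (nat \<Rightarrow> real^'n) \<Rightarrow> (nat \<Rightarrow> real^'n) \<Rightarrow> nat \<Rightarrow> bool"
  where "TSTMR_upto_half A b Mt Mh x xh k \<longleftrightarrow>
    one_param_step A b (delta1 A b Mt x 0) (x 0) (xh 0) \<and>
    (0 < k \<longrightarrow> one_param_step A b (delta1 A b Mh xh 0) (xh 0) (x 1)) \<and>
    (\<forall>j\<in>{1..k}. two_param_step A b (delta1 A b Mt x j) (delta2 A b Mt x j) (x j) (xh j)) \<and>
    (\<forall>j\<in>{1..<k}. two_param_step A b (delta1 A b Mh xh j) (delta2 A b Mh xh j) (xh j) (x (j + 1)))"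

end

theory Submission imports Defs begin

text \<open>The determinant of the Gram matrix \<open>W A u v\<close> is the gap in the squared
  Cauchy-Schwarz inequality for \<open>A *v u\<close> and \<open>A *v v\<close>, so singularity
  makes these parallel, and injectivity of \<open>A\<close> carries this back to \<open>u\<close>
  and \<open>v\<close> (\<open>singular_W_imp_scaleR\<close>). Hence \<open>delta1\<close> is a
  multiple \<nu> of the nonzero \<open>delta2\<close>. Multiplying by \<open>Mh\<close> turns this
  into r_k = \<nu> (r_k - r_(k-1)) for the half-step residuals: the combination of residuals with
  weights 1 - \<nu> and \<nu> vanishes.\<close>

lemma det_W: "det (W A u v) = (norm (A *v u) * norm (A *v v))\<^sup>2 - ((A *v u) \<bullet> (A *v v))\<^sup>2"
  by (simp add: W_def det_2 vector_2 dot_square_norm power_mult_distrib inner_commute)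
     (simp add: power2_eq_square)

text \<open>A singular Gram matrix is the equality case of the Cauchy--Schwarz inequality.\<close>

lemma singular_W_imp_scaleR:
  fixes A :: "real^'n^'n" and u v :: "real^'n"
  assumes A: "invertible A" and v: "v \<noteq> 0" and W: "\<not> invertible (W A u v)"
  obtains c where "u = c *\<^sub>R v"
proof -
  have inj: "y = z" if "A *v y = A *v z" for y z
    using that inj_matrix_vector_mult[OF A] by (simp add: inj_eq)
  have "det (W A u v) = 0"
    using W by (simp add: invertible_det_nz)
  then have "\<bar>(A *v v) \<bullet> (A *v u)\<bar>\<^sup>2 = (norm (A *v v) * norm (A *v u))\<^sup>2"
    by (simp add: det_W inner_commute mult.commute)
  then have "\<bar>(A *v v) \<bullet> (A *v u)\<bar> = norm (A *v v) * norm (A *v u)"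
    by (rule power2_eq_imp_eq) simp_all
  then have "collinear {0, A *v v, A *v u}"
    by (simp add: norm_cauchy_schwarz_equal)
  moreover have "A *v v \<noteq> 0"
    using v inj[of v 0] by auto
  \<comment> \<open>Collinearity with 0 leaves three cases: \<open>A *v v = 0\<close> is excluded,
    and \<open>A *v u = 0\<close> is covered by c = 0.\<close>
  ultimately obtain c where "A *v u = c *\<^sub>R (A *v v)"
    by (metis collinear_lemma scaleR_zero_left)
  then have "u = c *\<^sub>R v"
    using inj[of u "c *\<^sub>R v"] by (simp add: matrix_vector_mult_scaleR)
  then show thesis ..
qed

lemma matrix_inv_right:
  fixes M :: "'a::semiring_1^'n^'m"
  assumes "invertible M"
  shows "M ** matrix_inv M = mat 1"
  using someI_ex[OF assms[unfolded invertible_def]] by (simp add: matrix_inv_def)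

theorem proposition2p3:
  fixes A Mt Nt Mh Nh :: "real^'n^'n" and b :: "real^'n"
    and x xh :: "nat \<Rightarrow> real^'n" and k :: nat
  assumes "invertible A"
    and "A = Mt - Nt" and "invertible Mt"
    and "A = Mh - Nh" and "invertible Mh"
    and "k \<ge> 1"
    and "TSTMR_upto_half A b Mt Mh x xh k"
    and "delta1 A b Mh xh k \<noteq> 0"
    and "delta2 A b Mh xh k \<noteq> 0"
    and "\<not> invertible (W A (delta1 A b Mh xh k) (delta2 A b Mh xh k))"
  shows "\<exists>\<nu>::real. A *v ((1 - \<nu>) *\<^sub>R xh k + \<nu> *\<^sub>R xh (k - 1)) = b"
proof -
  obtain \<nu> where \<nu>: "delta1 A b Mh xh k = \<nu> *\<^sub>R delta2 A b Mh xh k"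
    using singular_W_imp_scaleR assms(1,9,10) by metis
  define r where "r j = residual A b (xh j)" for j
  have r: "Mh *v delta1 A b Mh xh j = r j" for j
    by (simp add: delta1_def r_def matrix_vector_mul_assoc matrix_inv_right \<open>invertible Mh\<close>)
  have "r k = \<nu> *\<^sub>R (r k - r (k - 1))"
    using arg_cong[OF \<nu>, of "(*v) Mh"]
    by (simp add: delta2_def matrix_vector_mult_scaleR matrix_vector_mult_diff_distrib r)
  \<comment> \<open>The weights sum to 1 and the residual is affine, so the residual at the combined
    point is (1 - \<nu>) r_k + \<nu> r_(k-1) = 0.\<close>
  then have "A *v ((1 - \<nu>) *\<^sub>R xh k + \<nu> *\<^sub>R xh (k - 1)) = b"
    by (simp add: r_def residual_def matrix_vector_right_distrib matrix_vector_mult_scaleR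
        algebra_simps)
  then show ?thesis ..
qed

end
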